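(* Let $s$ be an even positive integer, and let $cs_s(n)$ denote the number of $s$-CSYDs of $n$, i.e. of strict partitions $\lambda$ of $n$ such that $S(\lambda)$ is an $s$-CSYD. Then \[ \sum_{n=0}^{\infty}cs_s(n)q^n=\frac{(-q;q)_\infty\,(q^{s};q^{s})^{(s-2)/2}_\infty}{(-q^s;q^{s/2})_\infty}. \]
   Context: A strict partition $\lambda=(\lambda_1>\lambda_2>\cdots>\lambda_\ell)$ of $n$ is a finite (possibly empty) strictly decreasing sequence of positive integers with sum $n$. The shifted Young diagram $S(\lambda)$ has boxes $(i,j)$ (row $i$, column $j$) with $1\le i\le\ell$ and $i\le j\le i+\lambda_i-1$. The shifted hook length of a box $(i,j)$ is the number of boxes consisting of the box itself, the boxes to its right in row $i$, the boxes below it in column $j$, and all boxes of row $j+1$ of $S(\lambda)$ (if that row exists). $S(\lambda)$ is an $s$-CSYD ($s$-core shifted Young diagram) if no shifted hook length of $S(\lambda)$ is divisible by $s$. $(a;q)_\infty=\prod_{i\ge 0}(1-aq^i)$ for $|q|<1$, and $(a;q)_\infty^m$ means $\big((a;q)_\infty\big)^m$; the identity may be read as one of formal power series in $q$. *)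

theory Defs
  imports "HOL-Analysis.Analysis" "HOL-Computational_Algebra.Formal_Power_Series"
begin

definition strict_partition_of :: "nat \<Rightarrow> nat list \<Rightarrow> bool" where
  "strict_partition_of n lam \<longleftrightarrow>
     sorted_wrt (>) lam \<and> (\<forall>x\<in>set lam. 0 < x) \<and> sum_list lam = n"

(* Boxes are 1-based (row, column) pairs, whereas lists are 0-based: the i-th part is lam ! (i - 1). *)
definition shifted_diagram :: "nat list \<Rightarrow> (nat \<times> nat) set" where
  "shifted_diagram lam =
     {(i, j). 1 \<le> i \<and> i \<le> length lam \<and> i \<le> j \<and> j \<le> i + lam ! (i - 1) - 1}"

(* The four parts of the hook are pairwise disjoint, because row j + 1 only has boxes in
   columns > j; hence the hook length is the cardinality of their union. *)
definition shifted_hook :: "nat list \<Rightarrow> nat \<times> nat \<Rightarrow> (nat \<times> nat) set" where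
  "shifted_hook lam = (\<lambda>(i, j).
     {(i, j)}
     \<union> {(i', j') \<in> shifted_diagram lam. i' = i \<and> j' > j}
     \<union> {(i', j') \<in> shifted_diagram lam. j' = j \<and> i' > i}
     \<union> {(i', j') \<in> shifted_diagram lam. i' = j + 1})"

definition shifted_hook_length :: "nat list \<Rightarrow> nat \<times> nat \<Rightarrow> nat" where
  "shifted_hook_length lam b = card (shifted_hook lam b)"

definition is_csyd :: "nat \<Rightarrow> nat list \<Rightarrow> bool" where
  "is_csyd s lam \<longleftrightarrow> (\<forall>b\<in>shifted_diagram lam. \<not> s dvd shifted_hook_length lam b)"

definition cs :: "nat \<Rightarrow> nat \<Rightarrow> nat" where
  "cs s n = card {lam. strict_partition_of n lam \<and> is_csyd s lam}"

(* Used below with formal power series, where the infinite product is taken with respect to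
   the library's X-adic metric; it converges there by qpoch_inf_has_prod. *)
definition qpoch_inf :: "'a::{t2_space, comm_ring_1} \<Rightarrow> 'a \<Rightarrow> 'a" where
  "qpoch_inf a q = (\<Prod>i. 1 - a * q ^ i)"

lemma fps_nth_power_eq_0:
  fixes q :: "'a::comm_ring_1 fps"
  assumes "fps_nth q 0 = 0" "n < k"
  shows "fps_nth (q ^ k) n = 0"
  using assms by (simp add: startsby_zero_power_prefix)

lemma qpoch_inf_has_prod:
  fixes a q :: "'a::idom fps"
  assumes a: "fps_nth a 0 = 0" and q: "fps_nth q 0 = 0"
  shows "(\<lambda>i. 1 - a * q ^ i) has_prod qpoch_inf a q"
proof -
  define P where "P n = (\<Prod>i\<le>n. 1 - a * q ^ i)" for n
  define L where "L = Abs_fps (\<lambda>n. fps_nth (P n) n)"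
  have stable: "fps_nth (P m) n = fps_nth (P n) n" if "m \<ge> n" for m n
    using that
  proof (induction rule: dec_induct)
    case (step m)
    have "fps_nth (P m * a * q ^ Suc m) n = (\<Sum>i=0..n. fps_nth (P m * a) i * fps_nth (q ^ Suc m) (n - i))"
      by (rule fps_mult_nth)
    also have "\<dots> = 0"
    proof (rule sum.neutral, intro ballI)
      fix i
      have "fps_nth (q ^ Suc m) (n - i) = 0"
        by (rule fps_nth_power_eq_0) (use q step.hyps in auto)
      thus "fps_nth (P m * a) i * fps_nth (q ^ Suc m) (n - i) = 0"
        by (simp only: mult_zero_right)
    qed
    finally have "fps_nth (P m * a * q ^ Suc m) n = 0" .
    moreover have "P (Suc m) = P m * (1 - a * q ^ Suc m)"
      unfolding P_def by (simp only: prod.atMost_Suc)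
    hence "P (Suc m) = P m - P m * a * q ^ Suc m"
      by (simp only: right_diff_distrib mult_1_right mult.assoc)
    ultimately show ?case
      using step.IH by simp
  qed simp
  have "P \<longlonglongrightarrow> L"
  proof (rule tendsto_fpsI)
    fix n
    have "fps_nth (P m) n = fps_nth L n" if "m \<ge> n" for m
      unfolding L_def fps_nth_Abs_fps by (rule stable[OF that])
    thus "\<forall>\<^sub>F m in sequentially. fps_nth (P m) n = fps_nth L n"
      unfolding eventually_sequentially by blast
  qed
  moreover have "fps_nth L 0 = 1"
    using a by (simp add: L_def P_def)
  hence "L \<noteq> 0" by auto
  ultimately have "(\<lambda>i. 1 - a * q ^ i) has_prod L"
    unfolding has_prod_def raw_has_prod_def by (simp add: P_def [abs_def])
  thus ?thesis
    unfolding qpoch_inf_def using has_prod_unique by blast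
qed

end

theory Submission
  imports Defs
begin

text \<open>
  In a shifted diagram, the hook lengths in the row of a part \<open>y\<close> are the sums \<open>y + z\<close> with the
  smaller parts \<open>z\<close> and the differences \<open>y - x\<close> with the numbers \<open>0 \<le> x < y\<close> that are not parts
  (\<open>hook_lengths_of_row\<close>). Hence no hook length is divisible by \<open>s\<close> if and only if no part is
  divisible by \<open>s\<close>, the set of parts is closed under subtraction of \<open>s\<close> (while the result is
  positive), and no two distinct parts add up to a multiple of \<open>s\<close> (\<open>is_csyd_iff_csyd_set\<close>).

  Let \<open>s = 2h\<close>. In each nonzero residue class modulo \<open>s\<close> the parts form an initial segment; of two
  opposite classes \<open>r\<close> and \<open>s - r\<close> at most one is occupied; and the class of \<open>h\<close> contains at most
  the part \<open>h\<close>. So such a partition is an independent choice of one integer \<open>m\<close> for every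
  \<open>0 < r < h\<close>, its sign telling which of the two classes is occupied and its absolute value how many
  parts there are, and of whether \<open>h\<close> is a part. The choice \<open>m\<close> for \<open>r\<close> contributes
  \<open>r m(m+1)/2 + (s-r) m(m-1)/2\<close> to the size, so that the generating function is \<open>1 + q\<^sup>h\<close> times
  a product of theta functions \<open>f(q\<^bsup>r\<^esup>, q\<^bsup>s-r\<^esup>)\<close> (\<open>cs_generating_function_LIMSEQ\<close>).

  Jacobi's triple product (\<open>jacobi_triple_product_fps\<close>) turns each theta function into
  \<open>(-q\<^bsup>r\<^esup>; q\<^bsup>s\<^esup>) (-q\<^bsup>s-r\<^esup>; q\<^bsup>s\<^esup>) (q\<^bsup>s\<^esup>; q\<^bsup>s\<^esup>)\<close>, and regrouping the factors by residues
  modulo \<open>s\<close> gives the claim. The triple product is obtained as the \<open>X\<close>-adic limit of a finite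
  identity with Gaussian binomial coefficients.
\<close>

section \<open>Infinite products of formal power series\<close>

text \<open>
  Each coefficient of a product depends on finitely many coefficients of the factors, so
  multiplication is continuous in the \<open>X\<close>-adic topology. This lets identities between infinite
  products be obtained as limits of identities between finite ones.
\<close>

instance fps :: (comm_ring_1) topological_comm_monoid_mult
proof
  fix f g :: "'a fps"
  show "filterlim (\<lambda>x. fst x * snd x) (nhds (f * g)) (nhds f \<times>\<^sub>F nhds g)"
  proof (rule tendsto_fpsI)
    fix n
    have "eventually (\<lambda>x. (\<forall>k\<le>n. fps_nth (fst x) k = fps_nth f k)
             \<and> (\<forall>k\<le>n. fps_nth (snd x) k = fps_nth g k)) (nhds f \<times>\<^sub>F nhds g)"
      using eventually_prod_filter eventually_fps_nth_eq_nhds_fps_strong by fastforce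
    thus "eventually (\<lambda>x. fps_nth (fst x * snd x) n = fps_nth (f * g) n) (nhds f \<times>\<^sub>F nhds g)"
      by eventually_elim (auto simp: fps_mult_nth)
  qed
qed

lemma qpoch_inf_LIMSEQ:
  fixes a q :: "'a::idom fps"
  assumes "fps_nth a 0 = 0" "fps_nth q 0 = 0"
  shows "(\<lambda>n. \<Prod>i<n. 1 - a * q ^ i) \<longlonglongrightarrow> qpoch_inf a q"
  by (rule has_prod_imp_tendsto'[OF qpoch_inf_has_prod[OF assms]])

lemma prod_lessThan_mult_residues:
  fixes f :: "nat \<Rightarrow> 'a::comm_monoid_mult"
  shows "(\<Prod>i<n * s. f i) = (\<Prod>r<s. \<Prod>k<n. f (r + s * k))"
proof -
  have "(\<Prod>r<s. \<Prod>k<n. f (r + s * k)) = (\<Prod>k<n. \<Prod>r<s. f (r + s * k))"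
    by (rule prod.swap)
  also have "\<dots> = (\<Prod>k<n. prod f {k * s..<k * s+s})"
  proof (rule prod.cong[OF refl])
    fix k
    show "(\<Prod>r<s. f (r + s * k)) = prod f {k * s..<k * s+s}"
      by (rule prod.reindex_bij_witness[of _ "\<lambda>i. i - k * s" "\<lambda>r. r + s * k"]) (auto simp: mult.commute)
  qed
  also have "\<dots> = (\<Prod>i<n * s. f i)" by (rule prod.nat_group)
  finally show ?thesis ..
qed

text \<open>
  Sorting the factors \<open>1 - a q\<^sup>i\<close> by the residue of \<open>i\<close> modulo \<open>s\<close>.
\<close>

lemma qpoch_inf_split_residues:
  fixes a q :: "'a::idom fps"
  assumes "fps_nth a 0 = 0" "fps_nth q 0 = 0" "0 < s"
  shows "qpoch_inf a q = (\<Prod>r<s. qpoch_inf (a * q ^ r) (q ^ s))"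
proof -
  have "(\<lambda>n. \<Prod>i<n * s. 1 - a * q ^ i) \<longlonglongrightarrow> qpoch_inf a q"
    by (rule filterlim_compose[OF qpoch_inf_LIMSEQ[OF assms(1,2)]])
       (use \<open>0 < s\<close> in \<open>auto intro!: filterlim_at_top_mono[OF filterlim_ident]\<close>)
  moreover have "(\<lambda>n. \<Prod>i<n * s. 1 - a * q ^ i) = (\<lambda>n. \<Prod>r<s. \<Prod>k<n. 1 - (a * q ^ r) * (q ^ s) ^ k)"
    by (simp add: prod_lessThan_mult_residues power_add power_mult mult.assoc)
  moreover have "(\<lambda>n. \<Prod>r<s. \<Prod>k<n. 1 - (a * q ^ r) * (q ^ s) ^ k)
                   \<longlonglongrightarrow> (\<Prod>r<s. qpoch_inf (a * q ^ r) (q ^ s))"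
    by (intro tendsto_prod' qpoch_inf_LIMSEQ) (use assms in \<open>auto simp: fps_nth_power_0\<close>)
  ultimately show ?thesis using LIMSEQ_unique by metis
qed

lemma qpoch_inf_shift:
  fixes a q :: "'a::idom fps"
  assumes "fps_nth a 0 = 0" "fps_nth q 0 = 0"
  shows "qpoch_inf a q = (1 - a) * qpoch_inf (a * q) q"
proof -
  have "(\<lambda>n. \<Prod>i<Suc n. 1 - a * q ^ i) \<longlonglongrightarrow> qpoch_inf a q"
    by (rule LIMSEQ_Suc[OF qpoch_inf_LIMSEQ[OF assms]])
  moreover have "(\<lambda>n. \<Prod>i<Suc n. 1 - a * q ^ i) = (\<lambda>n. (1 - a) * (\<Prod>i<n. 1 - a * q * q ^ i))"
    by (simp only: prod.lessThan_Suc_shift) (simp add: mult.assoc)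
  moreover have "(\<lambda>n. (1 - a) * (\<Prod>i<n. 1 - a * q * q ^ i)) \<longlonglongrightarrow> (1 - a) * qpoch_inf (a * q) q"
    by (intro tendsto_mult tendsto_const qpoch_inf_LIMSEQ) (use assms in auto)
  ultimately show ?thesis using LIMSEQ_unique by metis
qed

lemma qpoch_inf_nth_0:
  fixes a q :: "'a::idom fps"
  assumes "fps_nth a 0 = 0" "fps_nth q 0 = 0"
  shows "fps_nth (qpoch_inf a q) 0 = 1"
proof -
  have "eventually (\<lambda>n. fps_nth (\<Prod>i<n. 1 - a * q ^ i) 0 = fps_nth (qpoch_inf a q) 0) sequentially"
    using qpoch_inf_LIMSEQ[OF assms] by (simp add: tendsto_fps_iff)
  moreover have "fps_nth (\<Prod>i<n. 1 - a * q ^ i) 0 = 1" for n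
    using assms by (induction n) auto
  ultimately show ?thesis by simp
qed

section \<open>Gaussian binomial coefficients\<close>

text \<open>
  Gaussian binomial coefficients, by one of the two \<open>q\<close>-Pascal rules; the recursion involves no
  division, so that the finite identities below hold in every commutative ring.
\<close>

fun qbinomial :: "'a::comm_ring_1 \<Rightarrow> nat \<Rightarrow> nat \<Rightarrow> 'a" where
  "qbinomial q n 0 = 1"
| "qbinomial q 0 (Suc k) = 0"
| "qbinomial q (Suc n) (Suc k) = qbinomial q n k + q ^ Suc k * qbinomial q n (Suc k)"

lemma qbinomial_eq_0: "n < k \<Longrightarrow> qbinomial q n k = 0"
  by (induction q n k rule: qbinomial.induct) auto

text \<open>
  The other \<open>q\<close>-Pascal rule. Both are needed below: one absorbs a new factor with \<open>a\<close>,
  the other a new factor with \<open>b\<close>.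
\<close>

lemma qbinomial_Suc_Suc':
  "k \<le> n \<Longrightarrow> qbinomial q (Suc n) (Suc k) = qbinomial q n (Suc k) + q ^ (n - k) * qbinomial q n k"
proof (induction n arbitrary: k)
  case 0
  thus ?case by simp
next
  case (Suc n)
  show ?case
  proof (cases k)
    case 0
    have "qbinomial q (Suc (Suc n)) (Suc 0) = 1 + q * qbinomial q (Suc n) (Suc 0)" by simp
    also have "qbinomial q (Suc n) (Suc 0) = qbinomial q n (Suc 0) + q ^ n"
      using Suc.IH[of 0] by simp
    also have "1 + q * (qbinomial q n (Suc 0) + q ^ n) = qbinomial q (Suc n) (Suc 0) + q ^ Suc n"
      by (simp add: algebra_simps)
    finally show ?thesis using 0 by simp
  next
    case (Suc k')
    show ?thesis
    proof (cases "k' = n")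
      case True
      thus ?thesis using Suc by (simp add: qbinomial_eq_0)
    next
      case False
      with Suc.prems Suc have k': "Suc k' \<le> n" by simp
      have e: "q ^ (n - k') = q * q ^ (n - Suc k')"
        using k' by (simp flip: power_Suc add: Suc_diff_Suc)
      have "qbinomial q (Suc (Suc n)) (Suc k)
              = qbinomial q (Suc n) (Suc k') + q ^ Suc (Suc k') * qbinomial q (Suc n) (Suc (Suc k'))"
        unfolding Suc by (rule qbinomial.simps(3))
      also have "\<dots> = (qbinomial q n (Suc k') + q ^ (n - k') * qbinomial q n k')
          + q ^ Suc (Suc k') * (qbinomial q n (Suc (Suc k')) + q ^ (n - Suc k') * qbinomial q n (Suc k'))"
        using Suc.IH[of k'] Suc.IH[of "Suc k'"] k' by simp
      also have "\<dots> = (qbinomial q n (Suc k') + q ^ Suc (Suc k') * qbinomial q n (Suc (Suc k')))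
          + q ^ (n - k') * (qbinomial q n k' + q ^ Suc k' * qbinomial q n (Suc k'))"
        unfolding e by (simp add: algebra_simps)
      also have "\<dots> = qbinomial q (Suc n) (Suc k) + q ^ (Suc n - k) * qbinomial q (Suc n) k"
        unfolding Suc by simp
      finally show ?thesis .
    qed
  qed
qed

text \<open>
  The product formula for Gaussian binomials, with denominators cleared.
\<close>

lemma qbinomial_times_qfactorials:
  "k \<le> n \<Longrightarrow> qbinomial q n k * (\<Prod>i<k. 1 - q ^ Suc i) * (\<Prod>i<n-k. 1 - q ^ Suc i)
                = (\<Prod>i<n. 1 - q ^ Suc i)"
proof (induction q n k rule: qbinomial.induct)
  case (3 q n k)
  show ?case
  proof (cases "k = n")
    case True
    thus ?thesis using 3 by (simp add: qbinomial_eq_0 flip: mult.assoc)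
  next
    case False
    with 3 have k: "Suc k \<le> n" by simp
    define F where "F m = (\<Prod>i<m. 1 - q ^ Suc i)" for m
    have F_Suc: "F (Suc m) = F m * (1 - q ^ Suc m)" for m
      unfolding F_def by (rule prod.lessThan_Suc)
    have IH: "qbinomial q n k * F k * F (n - k) = F n"
      "qbinomial q n (Suc k) * F (Suc k) * F (n - Suc k) = F n"
      using 3 k by (simp_all add: F_def)
    have Fnk: "F (n - k) = F (n - Suc k) * (1 - q ^ (n - k))"
      using k F_Suc[of "n - Suc k"] by (simp add: Suc_diff_Suc)
    have pw: "q ^ Suc n = q ^ Suc k * q ^ (n - k)"
      using k by (simp flip: power_add power_Suc)
    have "qbinomial q (Suc n) (Suc k) * F (Suc k) * F (Suc n - Suc k)
        = (1 - q ^ Suc k) * (qbinomial q n k * F k * F (n - k))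
          + q ^ Suc k * (1 - q ^ (n - k)) * (qbinomial q n (Suc k) * F (Suc k) * F (n - Suc k))"
      unfolding qbinomial.simps(3) diff_Suc_Suc by (simp only: F_Suc Fnk) (simp only: algebra_simps)
    also have "\<dots> = F n * (1 - q ^ Suc n)"
      unfolding IH pw by (simp only: algebra_simps mult_1_left mult_1_right)
    finally show ?thesis unfolding F_Suc[symmetric] by (simp add: F_def)
  qed
qed auto

section \<open>The finite triple product identity\<close>

text \<open>
  The general term \<open>a\<^bsup>m(m+1)/2\<^esup> b\<^bsup>m(m-1)/2\<^esup>\<close> of Ramanujan's theta function \<open>f(a, b)\<close>. Unlike the
  usual \<open>q\<^bsup>m(m-1)/2\<^esup> z\<^bsup>m\<^esup>\<close>, it has only nonnegative exponents for every integer \<open>m\<close>, hence makes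
  sense for power series \<open>a\<close>, \<open>b\<close> that are not invertible.
\<close>

definition theta_term :: "'a::comm_ring_1 \<Rightarrow> 'a \<Rightarrow> int \<Rightarrow> 'a" where
  "theta_term a b m = a ^ nat (m * (m + 1) div 2) * b ^ nat (m * (m - 1) div 2)"

lemma theta_term_minus: "theta_term a b (- m) = theta_term b a m"
  by (simp add: theta_term_def algebra_simps)

lemma consecutive_int_prod_nonneg: "0 \<le> m * (m + 1)" for m :: int
  by (cases "0 \<le> m") (auto simp: zero_le_mult_iff)

lemma triangular_step: "(m + 1) * (m + 2) div 2 = m * (m + 1) div 2 + (m + 1)" for m :: int
proof -
  have "(m + 1) * (m + 2) = m * (m + 1) + 2 * (m + 1)" by (simp add: algebra_simps)
  thus ?thesis by simp
qed

text \<open>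
  Consecutive terms have ratio \<open>a (ab)\<^bsup>m\<^esup>\<close>; for negative \<open>m\<close> this need not be defined in the ring, so the
  relation is multiplied by \<open>(ab)\<^bsup>n - m\<^esup>\<close>.
\<close>

lemma theta_term_step:
  assumes "int k = int n - m"
  shows "a * (a * b) ^ n * theta_term a b m = (a * b) ^ k * theta_term a b (m + 1)"
proof -
  have t1: "(m + 1) * (m + 1 + 1) div 2 = m * (m + 1) div 2 + (m + 1)"
    using triangular_step[of m] by (simp add: add.assoc)
  have t2: "(m + 1) * (m + 1 - 1) div 2 = m * (m - 1) div 2 + m"
    using triangular_step[of "m - 1"] by (simp add: algebra_simps)
  have p: "0 \<le> m * (m + 1) div 2" "0 \<le> m * (m - 1) div 2" "0 \<le> (m + 1) * (m + 1 + 1) div 2"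
      "0 \<le> (m + 1) * (m + 1 - 1) div 2"
    using consecutive_int_prod_nonneg[of m] consecutive_int_prod_nonneg[of "m - 1"]
      consecutive_int_prod_nonneg[of "m + 1"] by (simp_all add: algebra_simps)
  have e1: "Suc (n + nat (m * (m + 1) div 2)) = k + nat ((m + 1) * (m + 1 + 1) div 2)"
    using t1 p assms by linarith
  have e2: "n + nat (m * (m - 1) div 2) = k + nat ((m + 1) * (m + 1 - 1) div 2)"
    using t2 p assms by linarith
  have "a * (a * b) ^ n * theta_term a b m
      = a ^ Suc (n + nat (m * (m + 1) div 2)) * b ^ (n + nat (m * (m - 1) div 2))"
    by (simp add: theta_term_def power_mult_distrib power_add mult_ac)
  also have "\<dots> = (a * b) ^ k * theta_term a b (m + 1)"
    unfolding e1 e2 by (simp add: theta_term_def power_mult_distrib power_add mult_ac)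
  finally show ?thesis .
qed

text \<open>
  The \<open>q\<close>-binomial theorem in symmetric form, with \<open>q = ab\<close>. Multiplication by \<open>1 + a q\<^bsup>n\<^esup>\<close> moves
  part of each term one place up, multiplication by \<open>1 + b q\<^bsup>n'\<^esup>\<close> moves part of it one place down,
  and in both cases the coefficients recombine by a \<open>q\<close>-Pascal rule.
\<close>

lemma finite_triple_product:
  "(\<Prod>k<n. 1 + a * (a * b) ^ k) * (\<Prod>k<n'. 1 + b * (a * b) ^ k)
     = (\<Sum>j\<le>n + n'. qbinomial (a * b) (n + n') j * theta_term a b (int j - int n'))"
proof (induction n')
  case 0
  show ?case
  proof (induction n)
    case 0
    show ?case by (simp add: theta_term_def)
  next
    case (Suc n)
    let ?B = "qbinomial (a * b)" and ?T = "\<lambda>j. theta_term a b (int j)"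
    have "(\<Sum>j\<le>Suc n. ?B (Suc n) j * ?T j)
        = ?B (Suc n) 0 * ?T 0 + (\<Sum>j\<le>n. ?B (Suc n) (Suc j) * ?T (Suc j))"
      by (rule sum.atMost_Suc_shift)
    also have "(\<Sum>j\<le>n. ?B (Suc n) (Suc j) * ?T (Suc j))
        = (\<Sum>j\<le>n. ?B n (Suc j) * ?T (Suc j) + a * (a * b) ^ n * (?B n j * ?T j))"
    proof (rule sum.cong[OF refl])
      fix j assume "j \<in> {..n}"
      hence "j \<le> n" by simp
      have step: "a * (a * b) ^ n * ?T j = (a * b) ^ (n - j) * ?T (Suc j)"
        using theta_term_step[of "n - j" n "int j" a b] \<open>j \<le> n\<close> by (simp add: add.commute)
      have "a * (a * b) ^ n * (?B n j * ?T j) = ?B n j * (a * (a * b) ^ n * ?T j)"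
        by (simp only: mult_ac)
      also have "\<dots> = (a * b) ^ (n - j) * ?B n j * ?T (Suc j)"
        unfolding step by (simp only: mult_ac)
      finally show "?B (Suc n) (Suc j) * ?T (Suc j) = ?B n (Suc j) * ?T (Suc j) + a * (a * b) ^ n * (?B n j * ?T j)"
        by (simp only: qbinomial_Suc_Suc'[OF \<open>j \<le> n\<close>] distrib_right)
    qed
    also have "?B (Suc n) 0 * ?T 0 + \<dots>
        = (?B n 0 * ?T 0 + (\<Sum>j\<le>n. ?B n (Suc j) * ?T (Suc j))) + a * (a * b) ^ n * (\<Sum>j\<le>n. ?B n j * ?T j)"
      by (simp add: sum.distrib sum_distrib_left)
    also have "?B n 0 * ?T 0 + (\<Sum>j\<le>n. ?B n (Suc j) * ?T (Suc j)) = (\<Sum>j\<le>Suc n. ?B n j * ?T j)"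
      by (rule sum.atMost_Suc_shift[symmetric])
    also have "\<dots> = (\<Sum>j\<le>n. ?B n j * ?T j)"
      by (simp add: qbinomial_eq_0)
    finally have "(\<Sum>j\<le>Suc n. ?B (Suc n) j * ?T j) = (1 + a * (a * b) ^ n) * (\<Sum>j\<le>n. ?B n j * ?T j)"
      by (simp add: algebra_simps)
    with Suc show ?case by (simp add: mult.commute)
  qed
next
  case (Suc n')
  define N where "N = n + n'"
  let ?B = "qbinomial (a * b)" and ?T = "\<lambda>j. theta_term a b (int j - int n')"
    and ?S = "\<lambda>j. theta_term a b (int j - int (Suc n'))"
  have step: "b * (a * b) ^ n' * ?T j = (a * b) ^ j * ?S j" for j
    using theta_term_step[of j n' "int n' - int j" b a]
    by (simp add: theta_term_minus[of b a, symmetric] algebra_simps)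
  have "(\<Sum>j\<le>Suc N. ?B (Suc N) j * ?S j)
      = ?B (Suc N) 0 * ?S 0 + (\<Sum>j\<le>N. ?B (Suc N) (Suc j) * ?S (Suc j))"
    by (rule sum.atMost_Suc_shift)
  also have "(\<Sum>j\<le>N. ?B (Suc N) (Suc j) * ?S (Suc j))
      = (\<Sum>j\<le>N. ?B N j * ?T j) + (\<Sum>j\<le>N. ?B N (Suc j) * ((a * b) ^ Suc j * ?S (Suc j)))"
    by (simp add: algebra_simps sum.distrib)
  also have "?B (Suc N) 0 * ?S 0 + \<dots>
      = (\<Sum>j\<le>N. ?B N j * ?T j) + (?B N 0 * ((a * b) ^ 0 * ?S 0)
          + (\<Sum>j\<le>N. ?B N (Suc j) * ((a * b) ^ Suc j * ?S (Suc j))))"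
    by (simp only: qbinomial.simps(1) power_0 mult_1_left) (simp only: algebra_simps)
  also have "?B N 0 * ((a * b) ^ 0 * ?S 0) + (\<Sum>j\<le>N. ?B N (Suc j) * ((a * b) ^ Suc j * ?S (Suc j)))
      = (\<Sum>j\<le>Suc N. ?B N j * ((a * b) ^ j * ?S j))"
    by (rule sum.atMost_Suc_shift[symmetric])
  also have "\<dots> = (\<Sum>j\<le>N. ?B N j * (b * (a * b) ^ n' * ?T j))"
    unfolding step by (simp add: qbinomial_eq_0)
  also have "\<dots> = b * (a * b) ^ n' * (\<Sum>j\<le>N. ?B N j * ?T j)"
    by (simp add: sum_distrib_left mult_ac)
  finally have "(\<Sum>j\<le>Suc N. ?B (Suc N) j * ?S j) = (1 + b * (a * b) ^ n') * (\<Sum>j\<le>N. ?B N j * ?T j)"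
    by (simp add: algebra_simps)
  moreover have "(\<Prod>k<n. 1 + a * (a * b) ^ k) * (\<Prod>k<Suc n'. 1 + b * (a * b) ^ k)
      = (1 + b * (a * b) ^ n') * (\<Sum>j\<le>N. ?B N j * ?T j)"
    using Suc by (simp add: N_def mult_ac)
  ultimately show ?case by (simp add: N_def)
qed

section \<open>The Jacobi triple product identity\<close>

lemma fps_X_power_dvd_iff:
  fixes f :: "'a::field fps"
  shows "fps_X ^ n dvd f \<longleftrightarrow> (\<forall>k<n. fps_nth f k = 0)"
proof
  assume "fps_X ^ n dvd f"
  then obtain g where "f = fps_X ^ n * g" by (elim dvdE)
  thus "\<forall>k<n. fps_nth f k = 0" by (simp add: fps_X_power_mult_nth)
next
  assume *: "\<forall>k<n. fps_nth f k = 0"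
  have "f = fps_X ^ n * fps_shift n f"
    by (rule fps_ext) (use * in \<open>simp add: fps_X_power_mult_nth\<close>)
  thus "fps_X ^ n dvd f" by (metis dvd_triv_left)
qed

lemma qpoch_inf_minus_partial_dvd:
  fixes q :: "'a::field fps"
  assumes q: "fps_nth q 0 = 0"
  shows "fps_X ^ Suc k dvd qpoch_inf q q - (\<Prod>i<k. 1 - q ^ Suc i)"
proof -
  define F where "F m = (\<Prod>i<m. 1 - q ^ Suc i)" for m
  have Xq: "fps_X dvd q"
    using fps_X_power_dvd_iff[of 1 q] q by simp
  have tail: "fps_X ^ Suc k dvd F m - F k" if "k \<le> m" for m
    using that
  proof (induction rule: dec_induct)
    case (step m)
    have "fps_X ^ Suc k dvd q ^ Suc m"
      by (rule dvd_trans[OF le_imp_power_dvd dvd_power_same[OF Xq]]) (use step.hyps in simp)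
    hence "fps_X ^ Suc k dvd (F m - F k) - F m * q ^ Suc m"
      by (rule dvd_diff[OF step.IH dvd_mult])
    thus ?case by (simp add: F_def algebra_simps)
  qed simp
  have "F \<longlonglongrightarrow> qpoch_inf q q"
    using qpoch_inf_LIMSEQ[OF q q] by (simp add: F_def [abs_def])
  have "fps_nth (qpoch_inf q q - F k) n = 0" if "n < Suc k" for n
  proof -
    have "eventually (\<lambda>m. fps_nth (F m) n = fps_nth (qpoch_inf q q) n) sequentially"
      using \<open>F \<longlonglongrightarrow> qpoch_inf q q\<close> by (simp add: tendsto_fps_iff)
    then obtain m0 where "\<And>m. m0 \<le> m \<Longrightarrow> fps_nth (F m) n = fps_nth (qpoch_inf q q) n"
      by (auto simp: eventually_sequentially)
    hence "fps_nth (F (max m0 k)) n = fps_nth (qpoch_inf q q) n" by simp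
    moreover have "fps_nth (F (max m0 k) - F k) n = 0"
      using tail[of "max m0 k"] that by (auto simp: fps_X_power_dvd_iff simp del: power_Suc)
    ultimately show ?thesis by simp
  qed
  thus ?thesis unfolding fps_X_power_dvd_iff F_def by blast
qed

text \<open>
  As \<open>k\<close> and \<open>n - k\<close> grow, the Gaussian binomial tends to the reciprocal of the Euler product:
  modulo a power of \<open>X\<close>, all three finite products in the product formula may be replaced by the
  infinite one, one copy of which then cancels because its constant term is 1.
\<close>

lemma qbinomial_approx:
  fixes q :: "'a::field fps"
  assumes q: "fps_nth q 0 = 0" and k: "k \<le> n"
  shows "fps_X ^ min k (n - k) dvd qpoch_inf q q * qbinomial q n k - 1"
proof -
  define P where "P = qpoch_inf q q"
  define F where "F m = (\<Prod>i<m. 1 - q ^ Suc i)" for m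
  define B where "B = qbinomial q n k"
  let ?e = "min k (n - k)"
  have close: "fps_X ^ ?e dvd P - F m" if "?e \<le> m" for m
  proof (rule dvd_trans)
    show "fps_X ^ ?e dvd (fps_X :: 'a fps) ^ Suc m" using that by (intro le_imp_power_dvd) simp
    show "fps_X ^ Suc m dvd P - F m"
      unfolding P_def F_def by (rule qpoch_inf_minus_partial_dvd[OF q])
  qed
  have "B * F k * F (n - k) = F n"
    unfolding B_def F_def by (rule qbinomial_times_qfactorials[OF k])
  hence "P * (P * B - 1) = B * P * (P - F k) + B * F k * (P - F (n - k)) - (P - F n)"
    by (simp add: algebra_simps)
  also have "fps_X ^ ?e dvd \<dots>"
    by (intro dvd_diff dvd_add dvd_mult close) (use k in auto)
  finally have "fps_X ^ ?e dvd P * (P * B - 1)" .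
  moreover have "P dvd 1"
    using qpoch_inf_nth_0[OF q q] by (simp add: P_def)
  ultimately show ?thesis
    unfolding P_def B_def using dvd_mult_unit_iff' by blast
qed

lemma fps_X_power_dvd_theta_term:
  fixes a b :: "'a::field fps"
  assumes "fps_nth a 0 = 0" "fps_nth b 0 = 0"
  shows "fps_X ^ nat \<bar>m\<bar> dvd theta_term a b m"
proof -
  have X: "fps_X dvd a" "fps_X dvd b"
    using fps_X_power_dvd_iff[of 1 a] fps_X_power_dvd_iff[of 1 b] assms by simp_all
  let ?i = "nat (m * (m + 1) div 2)" and ?j = "nat (m * (m - 1) div 2)"
  have "fps_X ^ (?i + ?j) dvd theta_term a b m"
    unfolding theta_term_def power_add by (intro mult_dvd_mono dvd_power_same X)
  moreover have "nat \<bar>m\<bar> \<le> ?i + ?j"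
  proof -
    have "m * (m + 1) div 2 = m * (m - 1) div 2 + m"
      using triangular_step[of "m - 1"] by (simp add: algebra_simps)
    moreover have "0 \<le> m * (m - 1) div 2" "0 \<le> m * (m + 1) div 2"
      using consecutive_int_prod_nonneg[of m] consecutive_int_prod_nonneg[of "m - 1"]
      by (simp_all add: algebra_simps)
    ultimately show ?thesis by linarith
  qed
  ultimately show ?thesis by (meson dvd_trans le_imp_power_dvd)
qed

text \<open>
  The Jacobi triple product identity, as the limit of the finite one. After multiplication by the
  Euler product, the coefficient of \<open>theta_term a b m\<close> is 1 up to order \<open>M - \<bar>m\<bar>\<close>, and the term
  itself has order at least \<open>\<bar>m\<bar>\<close>; so the two sides agree up to order \<open>M\<close>, uniformly in \<open>m\<close>.
\<close>

theorem jacobi_triple_product_fps: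
  fixes a b :: "'a::field fps"
  assumes a: "fps_nth a 0 = 0" and b: "fps_nth b 0 = 0"
  shows "(\<lambda>M. \<Sum>m\<in>{- int M..int M}. theta_term a b m)
           \<longlonglongrightarrow> qpoch_inf (- a) (a * b) * qpoch_inf (- b) (a * b) * qpoch_inf (a * b) (a * b)"
    (is "?S \<longlonglongrightarrow> ?L")
proof -
  define q where "q = a * b"
  define P where "P = qpoch_inf q q"
  have q: "fps_nth q 0 = 0" using a by (simp add: q_def)
  define F where "F M = (\<Prod>k<M. 1 + a * q ^ k) * (\<Prod>k<M. 1 + b * q ^ k)" for M
  have "(\<lambda>M. (\<Prod>k<M. 1 - (- a) * q ^ k) * (\<Prod>k<M. 1 - (- b) * q ^ k) * P)
          \<longlonglongrightarrow> qpoch_inf (- a) q * qpoch_inf (- b) q * P"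
    by (intro tendsto_mult tendsto_const qpoch_inf_LIMSEQ) (use a b q in auto)
  hence lim: "(\<lambda>M. F M * P) \<longlonglongrightarrow> ?L"
    by (simp add: F_def P_def q_def)
  have close: "fps_X ^ M dvd F M * P - ?S M" for M
  proof -
    have "F M = (\<Sum>j\<le>M + M. qbinomial q (M + M) j * theta_term a b (int j - int M))"
      unfolding F_def q_def by (rule finite_triple_product)
    moreover have "?S M = (\<Sum>j\<le>M + M. theta_term a b (int j - int M))"
      by (rule sum.reindex_bij_witness[of _ "\<lambda>j. int j - int M" "\<lambda>m. nat (m + int M)"]) auto
    ultimately have "F M * P - ?S M
        = (\<Sum>j\<le>M + M. (P * qbinomial q (M + M) j - 1) * theta_term a b (int j - int M))"
      by (simp add: sum_distrib_left sum_distrib_right sum_subtractf algebra_simps)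
    also have "fps_X ^ M dvd \<dots>"
    proof (rule dvd_sum)
      fix j assume "j \<in> {..M + M}"
      hence j: "j \<le> M + M" by simp
      have "fps_X ^ (min j (M + M - j) + nat \<bar>int j - int M\<bar>)
              dvd (P * qbinomial q (M + M) j - 1) * theta_term a b (int j - int M)"
        unfolding power_add P_def
        by (intro mult_dvd_mono qbinomial_approx[OF q j] fps_X_power_dvd_theta_term[OF a b])
      moreover have "min j (M + M - j) + nat \<bar>int j - int M\<bar> = M"
        using j by linarith
      ultimately show "fps_X ^ M dvd (P * qbinomial q (M + M) j - 1) * theta_term a b (int j - int M)"
        by simp
    qed
    finally show ?thesis .
  qed
  show ?thesis
  proof (rule tendsto_fpsI)
    fix n
    have "eventually (\<lambda>M. fps_nth (F M * P) n = fps_nth ?L n) sequentially"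
      using lim by (simp add: tendsto_fps_iff)
    thus "eventually (\<lambda>M. fps_nth (?S M) n = fps_nth ?L n) sequentially"
      using eventually_gt_at_top[of n]
    proof eventually_elim
      case (elim M)
      have "fps_nth (F M * P - ?S M) n = 0"
        using close[of M] elim(2) by (simp only: fps_X_power_dvd_iff)
      thus ?case using elim(1) by simp
    qed
  qed
qed

section \<open>Shifted hook lengths\<close>

lemma card_shifted_hook:
  assumes lam: "sorted_wrt (>) lam" "\<forall>x\<in>set lam. 0 < x"
    and b: "(i, j) \<in> shifted_diagram lam"
  shows "shifted_hook_length lam (i, j)
    = (i + lam ! (i - 1) - j)
      + card {i'. i < i' \<and> i' \<le> length lam \<and> i' \<le> j \<and> j < i' + lam ! (i' - 1)}
      + (if j < length lam then lam ! j else 0)"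
proof -
  define C where "C = {i'. i < i' \<and> i' \<le> length lam \<and> i' \<le> j \<and> j < i' + lam ! (i' - 1)}"
  define R where "R = (if j < length lam then {j + 1..<j + 1 + lam ! j} else {})"
  have pos: "0 < lam ! k" if "k < length lam" for k using lam(2) that by simp
  have bnd: "1 \<le> i" "i \<le> length lam" "i \<le> j" "j < i + lam ! (i - 1)"
    using b pos[of "i - 1"] by (auto simp: shifted_diagram_def)
  have mem: "(k, l) \<in> shifted_diagram lam \<longleftrightarrow> 1 \<le> k \<and> k \<le> length lam \<and> k \<le> l \<and> l < k + lam ! (k - 1)"
    for k l using pos[of "k - 1"] by (auto simp: shifted_diagram_def)
  have "{(i, j)} \<union> {(i', j') \<in> shifted_diagram lam. i' = i \<and> j' > j} = {i} \<times> {j..<i + lam ! (i - 1)}"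
    unfolding mem using bnd by auto
  moreover have "{(i', j') \<in> shifted_diagram lam. j' = j \<and> i' > i} = C \<times> {j}"
    unfolding mem C_def using bnd by auto
  moreover have "{(i', j') \<in> shifted_diagram lam. i' = j + 1} = {j + 1} \<times> R"
    unfolding mem R_def by auto
  ultimately have "shifted_hook lam (i, j) = ({i} \<times> {j..<i + lam ! (i - 1)}) \<union> (C \<times> {j}) \<union> ({j + 1} \<times> R)"
    by (simp only: shifted_hook_def prod.case)
  moreover have "finite C" by (rule finite_subset[of _ "{..length lam}"]) (auto simp: C_def)
  moreover have "({i} \<times> {j..<i + lam ! (i - 1)}) \<inter> (C \<times> {j}) = {}" by (auto simp: C_def)
  moreover have "(({i} \<times> {j..<i + lam ! (i - 1)}) \<union> (C \<times> {j})) \<inter> ({j + 1} \<times> R) = {}"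
    using bnd by (auto simp: C_def R_def)
  moreover have "finite R" "card R = (if j < length lam then lam ! j else 0)" by (auto simp: R_def)
  ultimately show ?thesis
    unfolding shifted_hook_length_def C_def[symmetric]
    by (simp add: card_Un_disjoint card_cartesian_product)
qed

lemma nth_gap:
  fixes xs :: "nat list"
  assumes "sorted_wrt (>) xs" "k \<le> l" "l < length xs"
  shows "xs ! l + (l - k) \<le> xs ! k"
  using assms(2,3)
proof (induction rule: dec_induct)
  case (step m)
  have "xs ! Suc m < xs ! m" using assms(1) step.prems by (simp add: sorted_wrt_iff_nth_less)
  thus ?case using step by simp
qed simp

text \<open>
  The parts after the \<open>k\<close>-th are distinct and positive, so there is room for them below it. For
  the diagram this says that every row reaches the column numbered by the number of rows.
\<close>

lemma nth_ge_remaining_length: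
  fixes xs :: "nat list"
  assumes "sorted_wrt (>) xs" "\<forall>x\<in>set xs. 0 < x" "k < length xs"
  shows "length xs - k \<le> xs ! k"
proof -
  have "0 < xs ! (length xs - 1)" using assms(2,3) by simp
  with nth_gap[OF assms(1), of k "length xs - 1"] assms(3) show ?thesis by linarith
qed

text \<open>
  In a column \<open>j\<close> whose number is less than the number of rows, all boxes down to the diagonal are present;
  with the arm they contribute the part of row \<open>i\<close>, and row \<open>j + 1\<close> contributes its own part.
\<close>

lemma hook_length_short_column:
  assumes lam: "sorted_wrt (>) lam" "\<forall>x\<in>set lam. 0 < x"
    and i: "1 \<le> i" "i \<le> j" "j < length lam"
  shows "(i, j) \<in> shifted_diagram lam"
    and "shifted_hook_length lam (i, j) = lam ! (i - 1) + lam ! j"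
proof -
  have len: "length lam - (i' - 1) \<le> lam ! (i' - 1)" if "1 \<le> i'" "i' \<le> j" for i'
    using nth_ge_remaining_length[OF lam, of "i' - 1"] i that by simp
  show box: "(i, j) \<in> shifted_diagram lam"
    using i len[of i] by (auto simp: shifted_diagram_def)
  have "j < i' + lam ! (i' - 1)" if "i < i'" "i' \<le> j" for i'
    using len[of i'] that i by linarith
  hence "{i'. i < i' \<and> i' \<le> length lam \<and> i' \<le> j \<and> j < i' + lam ! (i' - 1)} = {i<..j}"
    using i by auto
  thus "shifted_hook_length lam (i, j) = lam ! (i - 1) + lam ! j"
    unfolding card_shifted_hook[OF lam box] using i len[of i] by simp
qed

text \<open>
  Here \<open>p\<close> is the last row meeting the column, so the column ends just before row \<open>p + 1\<close>; the
  number \<open>x\<close> of the column, counted from row \<open>p\<close>, lies strictly between the parts of rows \<open>p\<close>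
  and \<open>p + 1\<close>, hence is not a part. The value 0 occurs for \<open>x\<close> only when \<open>p\<close> is the last row.
\<close>

lemma hook_length_long_column:
  assumes lam: "sorted_wrt (>) lam" "\<forall>x\<in>set lam. 0 < x"
    and i: "1 \<le> i" "i \<le> p" "p \<le> length lam"
    and x: "x < lam ! (p - 1)" "p < length lam \<Longrightarrow> lam ! p < x"
  shows "length lam \<le> x + p" and "(i, x + p) \<in> shifted_diagram lam"
    and "shifted_hook_length lam (i, x + p) = lam ! (i - 1) - x"
proof -
  show len: "length lam \<le> x + p"
    using nth_ge_remaining_length[OF lam, of p] x(2) by (cases "p < length lam") auto
  have above: "x + p < i' + lam ! (i' - 1)" if "1 \<le> i'" "i' \<le> p" for i'
    using nth_gap[OF lam(1), of "i' - 1" "p - 1"] that i x(1) by linarith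
  have below: "i' + lam ! (i' - 1) \<le> x + p" if "p < i'" "i' \<le> length lam" for i'
    using nth_gap[OF lam(1), of p "i' - 1"] that x(2) by linarith
  show box: "(i, x + p) \<in> shifted_diagram lam"
    using i above[of i] by (auto simp: shifted_diagram_def)
  have "{i'. i < i' \<and> i' \<le> length lam \<and> i' \<le> x + p \<and> x + p < i' + lam ! (i' - 1)} = {i<..p}"
  proof (intro equalityI subsetI)
    fix i' assume "i' \<in> {i'. i < i' \<and> i' \<le> length lam \<and> i' \<le> x + p \<and> x + p < i' + lam ! (i' - 1)}"
    thus "i' \<in> {i<..p}" using below[of i'] by fastforce
  next
    fix i' assume "i' \<in> {i<..p}"
    thus "i' \<in> {i'. i < i' \<and> i' \<le> length lam \<and> i' \<le> x + p \<and> x + p < i' + lam ! (i' - 1)}"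
      using i above[of i'] by simp
  qed
  thus "shifted_hook_length lam (i, x + p) = lam ! (i - 1) - x"
    unfolding card_shifted_hook[OF lam box] using i above[of i] len by simp
qed

text \<open>
  The shifted analogue of the description of ordinary hook lengths by beta-numbers: the columns
  numbered less than the number of rows give sums with smaller parts, the other ones differences with gaps.
\<close>

lemma hook_lengths_of_row:
  assumes lam: "sorted_wrt (>) lam" "\<forall>x\<in>set lam. 0 < x" and i: "i < length lam"
  shows "{shifted_hook_length lam (Suc i, j) |j. (Suc i, j) \<in> shifted_diagram lam}
    = {lam ! i + z |z. z \<in> set lam \<and> z < lam ! i} \<union> {lam ! i - x |x. x < lam ! i \<and> x \<notin> set lam}"
    (is "?H = ?A \<union> ?B")
proof
  show "?H \<subseteq> ?A \<union> ?B"
  proof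
    fix h assume "h \<in> ?H"
    then obtain j where h: "h = shifted_hook_length lam (Suc i, j)"
      and box: "(Suc i, j) \<in> shifted_diagram lam" by blast
    show "h \<in> ?A \<union> ?B"
    proof (cases "j < length lam")
      case True
      have "lam ! j < lam ! i"
        using lam(1) True box by (simp add: sorted_wrt_iff_nth_less shifted_diagram_def)
      moreover have "h = lam ! i + lam ! j"
        using hook_length_short_column(2)[OF lam, of "Suc i" j] True box h
        by (simp add: shifted_diagram_def)
      ultimately show ?thesis using True by auto
    next
      case False
      \<comment> \<open>The maximum is the last row that meets column \<open>j\<close>.\<close>
      define Q where "Q = {p. Suc i \<le> p \<and> p \<le> length lam \<and> j < p + lam ! (p - 1)}"
      define p where "p = Max Q"
      have fin: "finite Q" by (rule finite_subset[of _ "{..length lam}"]) (auto simp: Q_def)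
      have "Suc i \<in> Q" using box by (auto simp: Q_def shifted_diagram_def)
      hence "p \<in> Q" unfolding p_def using fin by (intro Max_in) auto
      hence p: "Suc i \<le> p" "p \<le> length lam" "j < p + lam ! (p - 1)" by (auto simp: Q_def)
      have max: "p' + lam ! (p' - 1) \<le> j" if "p < p'" "p' \<le> length lam" for p'
      proof -
        have "p' \<notin> Q" using Max_ge[OF fin, of p'] that by (auto simp: p_def[symmetric])
        thus ?thesis using that p by (simp add: Q_def)
      qed
      define x where "x = j - p"
      have j: "j = x + p" using p False by (simp add: x_def)
      have x: "x < lam ! (p - 1)" using p j by simp
      have x': "lam ! p < x" if "p < length lam" using max[of "Suc p"] that j by simp
      have "h = lam ! i - x"
        using hook_length_long_column(3)[OF lam, of "Suc i" p x] p x x' h j by simp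
      moreover have "x < lam ! i"
        using nth_gap[OF lam(1), of i "p - 1"] p x by linarith
      moreover have "x \<notin> set lam"
      proof
        assume "x \<in> set lam"
        then obtain k where k: "k < length lam" "x = lam ! k" by (metis in_set_conv_nth)
        show False
        proof (cases "k < p")
          case True
          thus False using nth_gap[OF lam(1), of k "p - 1"] k p x by linarith
        next
          case False
          thus False using nth_gap[OF lam(1), of p k] k x' by simp
        qed
      qed
      ultimately show ?thesis by blast
    qed
  qed
next
  show "?A \<union> ?B \<subseteq> ?H"
  proof
    fix h assume "h \<in> ?A \<union> ?B"
    then consider (add) z where "h = lam ! i + z" "z \<in> set lam" "z < lam ! i"
      | (gap) x where "h = lam ! i - x" "x < lam ! i" "x \<notin> set lam" by blast
    thus "h \<in> ?H"
    proof cases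
      case add
      then obtain j where j: "j < length lam" "z = lam ! j" by (metis in_set_conv_nth)
      have "i < j"
      proof (rule ccontr)
        assume "\<not> i < j"
        thus False using nth_gap[OF lam(1), of j i] i j add by simp
      qed
      thus ?thesis
        using hook_length_short_column[OF lam, of "Suc i" j] j add by (auto intro!: exI[of _ j])
    next
      case gap
      \<comment> \<open>The maximum is the number of parts greater than \<open>x\<close>; the gap belongs to column \<open>x + p\<close>.\<close>
      define Q where "Q = {p. Suc i \<le> p \<and> p \<le> length lam \<and> x < lam ! (p - 1)}"
      define p where "p = Max Q"
      have fin: "finite Q" by (rule finite_subset[of _ "{..length lam}"]) (auto simp: Q_def)
      have "Suc i \<in> Q" using gap i by (auto simp: Q_def)
      hence "p \<in> Q" unfolding p_def using fin by (intro Max_in) auto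
      hence p: "Suc i \<le> p" "p \<le> length lam" "x < lam ! (p - 1)" by (auto simp: Q_def)
      have "lam ! p < x" if "p < length lam"
      proof -
        have "Suc p \<notin> Q" using Max_ge[OF fin, of "Suc p"] by (auto simp: p_def[symmetric])
        hence "lam ! p \<le> x" using p that by (simp add: Q_def)
        moreover have "lam ! p \<noteq> x" using gap that by auto
        ultimately show ?thesis by simp
      qed
      thus ?thesis
        using hook_length_long_column[OF lam, of "Suc i" p x] p gap by (auto intro!: exI[of _ "x + p"])
    qed
  qed
qed

lemma is_csyd_iff_parts:
  assumes lam: "sorted_wrt (>) lam" "\<forall>x\<in>set lam. 0 < x"
  shows "is_csyd s lam \<longleftrightarrow> (\<forall>y\<in>set lam.
           (\<forall>z\<in>set lam. z < y \<longrightarrow> \<not> s dvd y + z) \<and> (\<forall>x<y. x \<notin> set lam \<longrightarrow> \<not> s dvd y - x))"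
proof -
  have "is_csyd s lam \<longleftrightarrow> (\<forall>i<length lam.
      \<forall>h\<in>{shifted_hook_length lam (Suc i, j) |j. (Suc i, j) \<in> shifted_diagram lam}. \<not> s dvd h)"
    unfolding is_csyd_def
  proof (safe, goal_cases)
    case (2 i j)
    hence "1 \<le> i" "i \<le> length lam" by (auto simp: shifted_diagram_def)
    then obtain i' where "i = Suc i'" "i' < length lam" by (cases i) auto
    with 2 show ?case by blast
  qed auto
  also have "\<dots> \<longleftrightarrow> (\<forall>i<length lam. (\<forall>z\<in>set lam. z < lam ! i \<longrightarrow> \<not> s dvd lam ! i + z)
      \<and> (\<forall>x<lam ! i. x \<notin> set lam \<longrightarrow> \<not> s dvd lam ! i - x))"
    using hook_lengths_of_row[OF lam] by (intro all_cong1 imp_cong refl) (simp, blast)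
  finally show ?thesis by (metis in_set_conv_nth)
qed

section \<open>The hook condition as a condition on sets of parts\<close>

text \<open>
  The hook condition in terms of the set of parts alone. Each clause concerns a single residue class
  modulo \<open>s\<close> or two opposite ones, so the condition can be analysed one pair of classes at a time.
\<close>

definition csyd_set :: "nat \<Rightarrow> nat set \<Rightarrow> bool" where
  "csyd_set s A \<longleftrightarrow> finite A \<and> (\<forall>x\<in>A. \<not> s dvd x) \<and> (\<forall>x\<in>A. s < x \<longrightarrow> x - s \<in> A)
     \<and> (\<forall>x\<in>A. \<forall>y\<in>A. x \<noteq> y \<longrightarrow> \<not> s dvd x + y)"

lemma csyd_set_diff_mult:
  assumes "csyd_set s A" "y \<in> A" "k * s < y"
  shows "y - k * s \<in> A"
  using assms(3)
proof (induction k)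
  case (Suc k)
  hence "y - k * s \<in> A" "s < y - k * s" by simp_all
  hence "y - k * s - s \<in> A" using assms(1) unfolding csyd_set_def by blast
  thus ?case by (simp add: add.commute)
qed (use assms(2) in simp)

text \<open>
  A part \<open>y\<close> has the hook lengths \<open>y - x\<close> for the gaps \<open>x < y\<close>. The gap 0 excludes multiples of
  \<open>s\<close>, and \<open>y - s\<close> must not be a gap. Conversely, stepping down by \<open>s\<close> from a part meets only parts
  as long as it stays positive, so no gap is congruent to \<open>y\<close>.
\<close>

lemma is_csyd_iff_csyd_set:
  assumes lam: "sorted_wrt (>) lam" "\<forall>x\<in>set lam. 0 < x" and s: "0 < s"
  shows "is_csyd s lam \<longleftrightarrow> csyd_set s (set lam)"
proof
  assume "is_csyd s lam"
  hence sums: "\<And>y z. y \<in> set lam \<Longrightarrow> z \<in> set lam \<Longrightarrow> z < y \<Longrightarrow> \<not> s dvd y + z"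
    and gaps: "\<And>y x. y \<in> set lam \<Longrightarrow> x < y \<Longrightarrow> x \<notin> set lam \<Longrightarrow> \<not> s dvd y - x"
    unfolding is_csyd_iff_parts[OF lam] by blast+
  show "csyd_set s (set lam)"
    unfolding csyd_set_def
  proof (intro conjI ballI impI)
    fix x assume x: "x \<in> set lam"
    show "\<not> s dvd x" using gaps[OF x, of 0] lam(2) x by auto
    show "x - s \<in> set lam" if "s < x"
    proof (rule ccontr)
      assume "x - s \<notin> set lam"
      with gaps[OF x, of "x - s"] that s show False by simp
    qed
  next
    fix x y assume xy: "x \<in> set lam" "y \<in> set lam" "x \<noteq> y"
    show "\<not> s dvd x + y"
      using sums[OF xy(1,2)] sums[OF xy(2,1)] xy(3) by (cases x y rule: linorder_cases) (auto simp: add.commute)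
  qed simp
next
  assume A: "csyd_set s (set lam)"
  show "is_csyd s lam"
    unfolding is_csyd_iff_parts[OF lam]
  proof (intro ballI conjI allI impI)
    fix y z assume "y \<in> set lam" "z \<in> set lam" "z < y"
    thus "\<not> s dvd y + z" using A by (simp add: csyd_set_def)
  next
    fix y x assume y: "y \<in> set lam" and x: "x < y" "x \<notin> set lam"
    show "\<not> s dvd y - x"
    proof
      assume "s dvd y - x"
      then obtain k where k: "y - x = k * s" by (metis dvdE mult.commute)
      hence y_eq: "y = x + k * s" using x by simp
      show False
      proof (cases "x = 0")
        case True
        hence "s dvd y" using y_eq by simp
        thus False using A y by (simp add: csyd_set_def)
      next
        case False
        thus False using csyd_set_diff_mult[OF A y, of k] x y_eq by simp
      qed
    qed
  qed
qed

lemma cs_eq_card_csyd_sets: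
  assumes s: "0 < s"
  shows "cs s n = card {A. csyd_set s A \<and> \<Sum>A = n}"
proof -
  have "bij_betw set {lam. strict_partition_of n lam \<and> is_csyd s lam} {A. csyd_set s A \<and> \<Sum>A = n}"
  proof (rule bij_betw_byWitness[where f' = "\<lambda>A. rev (sorted_list_of_set A)"])
    have rev_sorted: "rev (sorted_list_of_set (set lam)) = lam" if "sorted_wrt (>) lam" for lam :: "nat list"
    proof -
      have "sorted_wrt (<) (rev lam)" using that by (simp add: sorted_wrt_rev)
      hence "sorted_list_of_set (set (rev lam)) = rev lam"
        by (intro strict_sorted_equal) auto
      thus ?thesis by simp
    qed
    show "\<forall>lam\<in>{lam. strict_partition_of n lam \<and> is_csyd s lam}. rev (sorted_list_of_set (set lam)) = lam"
      using rev_sorted by (auto simp: strict_partition_of_def)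
    show "\<forall>A\<in>{A. csyd_set s A \<and> \<Sum>A = n}. set (rev (sorted_list_of_set A)) = A"
      by (auto simp: csyd_set_def)
    show "set ` {lam. strict_partition_of n lam \<and> is_csyd s lam} \<subseteq> {A. csyd_set s A \<and> \<Sum>A = n}"
    proof safe
      fix lam assume *: "strict_partition_of n lam" "is_csyd s lam"
      hence "sorted_wrt (<) (rev lam)" by (simp add: strict_partition_of_def sorted_wrt_rev)
      hence "distinct lam" by (metis distinct_rev strict_sorted_iff)
      thus "\<Sum> (set lam) = n"
        using * by (simp add: strict_partition_of_def sum_list_distinct_conv_sum_set[of _ "\<lambda>x. x", simplified])
      show "csyd_set s (set lam)"
        using * is_csyd_iff_csyd_set[OF _ _ s] by (simp add: strict_partition_of_def)
    qed
    show "(\<lambda>A. rev (sorted_list_of_set A)) ` {A. csyd_set s A \<and> \<Sum>A = n}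
            \<subseteq> {lam. strict_partition_of n lam \<and> is_csyd s lam}"
    proof safe
      fix A assume A: "csyd_set s A" and n: "n = \<Sum>A"
      let ?lam = "rev (sorted_list_of_set A)"
      have fin: "finite A" using A by (simp add: csyd_set_def)
      have sorted: "sorted_wrt (>) ?lam" by (simp add: sorted_wrt_rev)
      have pos: "\<forall>x\<in>set ?lam. 0 < x" using A fin by (auto simp: csyd_set_def intro: gr0I)
      have "sum_list ?lam = \<Sum>A"
        using fin sum_list_distinct_conv_sum_set[of "sorted_list_of_set A" "\<lambda>x. x"] by simp
      with sorted pos show "strict_partition_of (\<Sum>A) ?lam" by (simp add: strict_partition_of_def)
      show "is_csyd s ?lam" using is_csyd_iff_csyd_set[OF sorted pos s] A fin by simp
    qed
  qed
  thus ?thesis unfolding cs_def by (rule bij_betw_same_card)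
qed

section \<open>Decomposition by residue classes\<close>

text \<open>
  The parts with residue \<open>r\<close> or \<open>s - r\<close>. A set satisfying \<open>csyd_set\<close> contains an initial segment
  of each residue class, and one of two opposite classes is empty, so a single integer records both:
  it counts elements in class \<open>r\<close> if positive, and in class \<open>s - r\<close> if negative.
\<close>

definition runner :: "nat \<Rightarrow> nat \<Rightarrow> int \<Rightarrow> nat set" where
  "runner s r m = {x. x mod s = r \<and> int (x div s) < m} \<union> {x. x mod s = s - r \<and> int (x div s) < - m}"

lemma residue_class_initial:
  fixes s r k :: nat
  assumes "r < s"
  shows "{x. x mod s = r \<and> x div s < k} = (\<lambda>i. r + s * i) ` {..<k}"
proof (intro equalityI subsetI)
  fix x assume "x \<in> {x. x mod s = r \<and> x div s < k}"
  moreover from this have "x = r + s * (x div s)" by (metis (mono_tags) mem_Collect_eq mod_mult_div_eq)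
  ultimately show "x \<in> (\<lambda>i. r + s * i) ` {..<k}" by blast
qed (use assms in auto)

lemma sum_residue_class_initial:
  fixes s r k :: nat
  assumes "r < s"
  shows "\<Sum>{x. x mod s = r \<and> x div s < k} = k * r + s * (k * (k - 1) div 2)"
proof -
  have "inj_on (\<lambda>i. r + s * i) {..<k}" using assms by (auto intro: inj_onI)
  hence "\<Sum>{x. x mod s = r \<and> x div s < k} = (\<Sum>i<k. r + s * i)"
    unfolding residue_class_initial[OF assms] by (simp add: sum.reindex)
  also have "\<dots> = k * r + s * (\<Sum>i<k. i)"
    by (simp add: sum.distrib sum_distrib_left)
  also have "(\<Sum>i<k. i) = k * (k - 1) div 2"
    using Sum_Ico_nat[of 0 k] by (simp add: atLeast0LessThan)
  finally show ?thesis .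
qed

lemma finite_residue_class_initial:
  fixes s r k :: nat
  assumes "r < s"
  shows "finite {x. x mod s = r \<and> x div s < k}"
  unfolding residue_class_initial[OF assms] by simp

lemma runner_nonneg: "runner s r (int k) = {x. x mod s = r \<and> x div s < k}"
  by (auto simp: runner_def)

lemma runner_minus:
  assumes "r \<le> s"
  shows "runner s r (- m) = runner s (s - r) m"
  using assms by (auto simp: runner_def)

lemma runner_cases:
  assumes "0 < r" "r < s"
  obtains k where "m = int k" "runner s r m = {x. x mod s = r \<and> x div s < k}"
    | k where "m = - int k" "runner s r m = {x. x mod s = s - r \<and> x div s < k}"
proof (cases m rule: int_cases2)
  case (nonneg k)
  thus ?thesis using that(1) runner_nonneg by simp
next
  case (nonpos k)
  thus ?thesis using that(2) runner_minus[of r s "int k"] assms runner_nonneg by simp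
qed

lemma finite_runner: "0 < r \<Longrightarrow> r < s \<Longrightarrow> finite (runner s r m)"
  by (rule runner_cases[of r s m]) (simp_all add: finite_residue_class_initial)

text \<open>
  The triangular exponents are those of a theta term with \<open>a = X\<^bsup>r\<^esup>\<close> and \<open>b = X\<^bsup>s-r\<^esup>\<close>.
\<close>

lemma sum_runner:
  assumes "0 < r" "r < s"
  shows "\<Sum>(runner s r m) = r * nat (m * (m + 1) div 2) + (s - r) * nat (m * (m - 1) div 2)"
proof -
  have tri: "nat (int k * (int k - 1) div 2) = k * (k - 1) div 2"
    "nat (int k * (int k + 1) div 2) = k + k * (k - 1) div 2" for k
  proof -
    show *: "nat (int k * (int k - 1) div 2) = k * (k - 1) div 2"
    proof -
      have "int (k * (k - 1) div 2) = int k * (int k - 1) div 2"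
        by (cases k) (simp_all add: zdiv_int algebra_simps)
      thus ?thesis by (metis nat_int)
    qed
    have "int k * (int k + 1) = int k * (int k - 1) + 2 * int k" by (simp add: algebra_simps)
    hence "int k * (int k + 1) div 2 = int k * (int k - 1) div 2 + int k" by simp
    moreover have "0 \<le> int k * (int k - 1) div 2" by (cases k) auto
    ultimately show "nat (int k * (int k + 1) div 2) = k + k * (k - 1) div 2"
      using * by linarith
  qed
  show ?thesis
  proof (rule runner_cases[OF assms, of m])
    fix k assume m: "m = int k" and R: "runner s r m = {x. x mod s = r \<and> x div s < k}"
    define t where "t = k * (k - 1) div 2"
    obtain d where s: "s = r + d" using assms by (metis less_imp_add_positive)
    have "\<Sum>(runner s r m) = k * r + s * t"
      unfolding R t_def by (rule sum_residue_class_initial) (use assms in simp)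
    thus ?thesis unfolding m tri t_def[symmetric] by (simp add: s algebra_simps)
  next
    fix k assume m: "m = - int k" and R: "runner s r m = {x. x mod s = s - r \<and> x div s < k}"
    define t where "t = k * (k - 1) div 2"
    obtain d where s: "s = r + d" using assms by (metis less_imp_add_positive)
    have "\<Sum>(runner s r m) = k * (s - r) + s * t"
      unfolding R t_def by (rule sum_residue_class_initial) (use assms in simp)
    moreover have "m * (m + 1) = int k * (int k - 1)" "m * (m - 1) = int k * (int k + 1)"
      by (simp_all add: m algebra_simps)
    hence "nat (m * (m + 1) div 2) = t" "nat (m * (m - 1) div 2) = k + t"
      by (simp_all only: tri t_def)
    ultimately show ?thesis by (simp add: s algebra_simps)
  qed
qed

text \<open>
  Truncation at \<open>M\<close> keeps all sums finite. The class of \<open>h = s/2\<close> is its own opposite: two of its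
  elements would add up to a multiple of \<open>s\<close>, so it contains at most the part \<open>h\<close> itself.
\<close>

definition charge_range :: "nat \<Rightarrow> nat \<Rightarrow> nat \<Rightarrow> int set" where
  "charge_range h M r = (if r = h then {0, 1} else {- int M..int M})"

definition charges_to_set :: "nat \<Rightarrow> (nat \<Rightarrow> int) \<Rightarrow> nat set" where
  "charges_to_set h f = (\<Union>r\<in>{1..h}. runner (2 * h) r (f r))"

text \<open>
  Membership read off from the residue and the quotient of \<open>x\<close>. In class \<open>h\<close> the two halves of the
  runner coincide, and the negative half is empty because the charge is 0 or 1.
\<close>

lemma mem_charges_to_set:
  assumes h: "0 < h" and f: "f \<in> PiE {1..h} (charge_range h M)"
  shows "x \<in> charges_to_set h f \<longleftrightarrow>
    (let c = x mod (2 * h); i = int (x div (2 * h)) in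
       0 < c \<and> (if c \<le> h then i < f c else i < - f (2 * h - c)))"
proof -
  define c where "c = x mod (2 * h)"
  define i where "i = int (x div (2 * h))"
  have c: "c < 2 * h" using h by (simp add: c_def)
  have i: "0 \<le> i" by (simp add: i_def)
  have fh: "f h \<in> {0, 1}" using PiE_mem[OF f, of h] h by (simp add: charge_range_def)
  have "x \<in> charges_to_set h f \<longleftrightarrow> (\<exists>r\<in>{1..h}. c = r \<and> i < f r \<or> c = 2 * h - r \<and> i < - f r)"
    by (auto simp: charges_to_set_def runner_def c_def i_def)
  also have "\<dots> \<longleftrightarrow> 0 < c \<and> (if c \<le> h then i < f c else i < - f (2 * h - c))"
  proof
    assume "\<exists>r\<in>{1..h}. c = r \<and> i < f r \<or> c = 2 * h - r \<and> i < - f r"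
    then obtain r where r: "1 \<le> r" "r \<le> h" "c = r \<and> i < f r \<or> c = 2 * h - r \<and> i < - f r" by auto
    show "0 < c \<and> (if c \<le> h then i < f c else i < - f (2 * h - c))"
      using r(3)
    proof
      assume "c = 2 * h - r \<and> i < - f r"
      moreover from this have "r \<noteq> h" using fh i by auto
      ultimately show ?thesis using r by auto
    qed (use r in auto)
  next
    assume *: "0 < c \<and> (if c \<le> h then i < f c else i < - f (2 * h - c))"
    show "\<exists>r\<in>{1..h}. c = r \<and> i < f r \<or> c = 2 * h - r \<and> i < - f r"
    proof (cases "c \<le> h")
      case True
      thus ?thesis using * by (intro bexI[of _ c]) auto
    next
      case False
      thus ?thesis using * c by (intro bexI[of _ "2 * h - c"]) auto
    qed
  qed
  finally show ?thesis by (simp add: Let_def c_def i_def)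
qed

text \<open>
  If \<open>s\<close> divides \<open>x + y\<close>, the residues of \<open>x\<close> and \<open>y\<close> are opposite. Then the charge of their
  runner would have to be both positive and negative, or both are equal to \<open>h\<close>.
\<close>

lemma csyd_set_charges_to_set:
  assumes h: "0 < h" and f: "f \<in> PiE {1..h} (charge_range h M)"
  shows "csyd_set (2 * h) (charges_to_set h f)"
  unfolding csyd_set_def
proof (intro conjI ballI impI)
  note mem = mem_charges_to_set[OF h f, unfolded Let_def]
  show "finite (charges_to_set h f)"
    unfolding charges_to_set_def by (intro finite_UN_I finite_runner) auto
  fix x assume x: "x \<in> charges_to_set h f"
  show "\<not> 2 * h dvd x" using x unfolding mem by (auto simp: mod_eq_0_iff_dvd[symmetric])
  show "x - 2 * h \<in> charges_to_set h f" if "2 * h < x"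
  proof -
    have "(x - 2 * h) mod (2 * h) = x mod (2 * h)" using that by (simp add: le_mod_geq[symmetric])
    moreover have "(x - 2 * h) div (2 * h) \<le> x div (2 * h)" by (simp add: div_le_mono)
    ultimately show ?thesis using x unfolding mem by (auto split: if_splits)
  qed
  fix y assume y: "y \<in> charges_to_set h f" and "x \<noteq> y"
  show "\<not> 2 * h dvd x + y"
  proof
    assume dvd: "2 * h dvd x + y"
    define c d where "c = x mod (2 * h)" and "d = y mod (2 * h)"
    have "(c + d) mod (2 * h) = 0" using dvd by (simp add: c_def d_def mod_add_eq)
    moreover have "c < 2 * h" "d < 2 * h" "0 < c" "0 < d"
      using h x y unfolding mem by (auto simp: c_def d_def)
    ultimately have cd: "c + d = 2 * h"
      by (cases "c + d < 2 * h") (auto simp: mod_if split: if_splits)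
    have px: "if c \<le> h then int (x div (2 * h)) < f c else int (x div (2 * h)) < - f (2 * h - c)"
      and py: "if d \<le> h then int (y div (2 * h)) < f d else int (y div (2 * h)) < - f (2 * h - d)"
      using x y unfolding mem c_def d_def by blast+
    consider "c < h" "d > h" | "c > h" "d < h" | "c = h" "d = h" using cd by linarith
    thus False
    proof cases
      case 1
      hence "2 * h - d = c" using cd by simp
      thus False using 1 px py by simp
    next
      case 2
      hence "2 * h - c = d" using cd by simp
      thus False using 2 px py by simp
    next
      case 3
      moreover have "f h \<in> {0, 1}" using PiE_mem[OF f, of h] h by (simp add: charge_range_def)
      ultimately have "x div (2 * h) = 0" "y div (2 * h) = 0" using px py by auto
      moreover have "x mod (2 * h) = y mod (2 * h)" using 3 by (simp add: c_def d_def)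
      ultimately have "x = y" by (metis div_mult_mod_eq)
      thus False using \<open>x \<noteq> y\<close> by simp
    qed
  qed
qed

lemma inj_on_charges_to_set:
  assumes h: "0 < h"
  shows "inj_on (charges_to_set h) (PiE {1..h} (charge_range h M))"
proof (rule inj_onI)
  fix f g
  assume f: "f \<in> PiE {1..h} (charge_range h M)" and g: "g \<in> PiE {1..h} (charge_range h M)"
    and eq: "charges_to_set h f = charges_to_set h g"
  show "f = g"
  proof (rule PiE_ext[OF f g])
    fix r assume r: "r \<in> {1..h}"
    have dm: "(c + n * i) mod n = c" "(c + n * i) div n = i" if "c < n" for c n i :: nat
      using that by simp_all
    have pos: "int i < f r \<longleftrightarrow> int i < g r" for i
    proof -
      have "r < 2 * h" using r by auto
      from dm[OF this]
      have "(r + 2 * h * i) mod (2 * h) = r" "(r + 2 * h * i) div (2 * h) = i" by blast+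
      thus ?thesis
        using mem_charges_to_set[OF h f, of "r + 2 * h * i"] mem_charges_to_set[OF h g, of "r + 2 * h * i"]
          eq r by (simp add: Let_def)
    qed
    \<comment> \<open>At the self-opposite residue both sides are false, as the charges there are nonnegative.\<close>
    have neg: "int i < - f r \<longleftrightarrow> int i < - g r" for i
    proof (cases "r = h")
      case True
      have "f r \<in> {0, 1}" "g r \<in> {0, 1}"
        using PiE_mem[OF f r] PiE_mem[OF g r] True by (simp_all add: charge_range_def)
      thus ?thesis by auto
    next
      case False
      hence lt: "2 * h - r < 2 * h" "\<not> 2 * h - r \<le> h" "2 * h - (2 * h - r) = r" using r by auto
      have "(2 * h - r + 2 * h * i) mod (2 * h) = 2 * h - r" "(2 * h - r + 2 * h * i) div (2 * h) = i"
        using dm[OF lt(1)] by blast+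
      thus ?thesis
        using mem_charges_to_set[OF h f, of "2 * h - r + 2 * h * i"]
          mem_charges_to_set[OF h g, of "2 * h - r + 2 * h * i"] eq r lt by (simp add: Let_def)
    qed
    show "f r = g r"
    proof (rule ccontr)
      assume "f r \<noteq> g r"
      thus False
        using pos[of 0] pos[of "nat (f r)"] pos[of "nat (g r)"]
          neg[of "nat (- f r)"] neg[of "nat (- g r)"] by (auto split: if_splits)
    qed
  qed
qed

lemma downward_closed_eq_lessThan_card:
  fixes I :: "nat set"
  assumes "finite I" "\<And>i. Suc i \<in> I \<Longrightarrow> i \<in> I"
  shows "I = {..<card I}"
proof -
  have down: "j \<in> I" if "j \<le> i" "i \<in> I" for i j
    using that by (induction rule: inc_induct) (auto intro: assms(2))
  have "i < card I" if "i \<in> I" for i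
  proof -
    have "{..i} \<subseteq> I" using down that by auto
    from card_mono[OF assms(1) this] show ?thesis by simp
  qed
  hence "I \<subseteq> {..<card I}" by auto
  thus ?thesis by (intro card_subset_eq) auto
qed

text \<open>
  Closure under subtraction of \<open>s\<close> makes the quotients in each class an initial segment. If two
  opposite classes were both nonempty, their least elements would add up to \<open>s\<close>, and two elements in
  the class of \<open>h\<close> would make \<open>h\<close> and \<open>h + s\<close> parts, with sum \<open>2s\<close>. A class has no more elements than the sum of
  all parts, which is why the truncation at \<open>M\<close> loses nothing.
\<close>

lemma csyd_set_eq_charges_to_set:
  assumes h: "0 < h" and A: "csyd_set (2 * h) A" and M: "\<Sum>A \<le> M"
  shows "\<exists>f\<in>PiE {1..h} (charge_range h M). charges_to_set h f = A"
proof -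
  define s where "s = 2 * h"
  have fin: "finite A" and nd: "\<And>x. x \<in> A \<Longrightarrow> \<not> s dvd x"
    and down: "\<And>x. x \<in> A \<Longrightarrow> s < x \<Longrightarrow> x - s \<in> A"
    and pairs: "\<And>x y. x \<in> A \<Longrightarrow> y \<in> A \<Longrightarrow> x \<noteq> y \<Longrightarrow> \<not> s dvd x + y"
    using A by (auto simp: csyd_set_def s_def)
  define I where "I c = {i. c + s * i \<in> A}" for c
  define k where "k c = card (I c)" for c
  have inj: "inj_on (\<lambda>i. c + s * i) B" for c B using h by (auto simp: s_def intro: inj_onI)
  have finI: "finite (I c)" for c
    unfolding I_def using finite_vimageI[OF fin inj[of c UNIV]] by (simp add: vimage_def)
  have I: "I c = {..<k c}" if "0 < c" for c
    unfolding k_def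
  proof (rule downward_closed_eq_lessThan_card[OF finI])
    fix i assume "Suc i \<in> I c"
    thus "i \<in> I c" using down[of "c + s * Suc i"] that by (simp add: I_def algebra_simps)
  qed
  have mem: "x \<in> A \<longleftrightarrow> 0 < x mod s \<and> x div s < k (x mod s)" for x
  proof (cases "x mod s = 0")
    case True
    thus ?thesis using nd[of x] by (auto simp: mod_eq_0_iff_dvd)
  next
    case False
    have "x \<in> A \<longleftrightarrow> x div s \<in> I (x mod s)" by (simp add: I_def)
    thus ?thesis using I[of "x mod s"] False by auto
  qed
  have k_le: "k c \<le> M" for c
  proof -
    have "k c \<le> card A"
      unfolding k_def by (rule card_inj_on_le[OF inj _ fin]) (auto simp: I_def)
    also have "\<dots> = (\<Sum>x\<in>A. 1)" by simp
    also have "\<dots> \<le> \<Sum>A"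
    proof (rule sum_mono)
      fix x assume "x \<in> A"
      thus "1 \<le> x" using nd[of x] by (cases x) auto
    qed
    finally show ?thesis using M by simp
  qed
  have opposite: "k c = 0 \<or> k (s - c) = 0" if "0 < c" "c < h" for c
  proof (rule ccontr)
    assume "\<not> ?thesis"
    hence "0 \<in> I c" "0 \<in> I (s - c)" using I[of c] I[of "s - c"] that by (auto simp: s_def)
    hence "c \<in> A" "s - c \<in> A" by (auto simp: I_def)
    moreover have "c \<noteq> s - c" using that unfolding s_def by linarith
    ultimately have "\<not> s dvd c + (s - c)" by (rule pairs)
    thus False using that by (simp add: s_def)
  qed
  have middle: "k h \<le> 1"
  proof (rule ccontr)
    assume "\<not> k h \<le> 1"
    hence "0 \<in> I h" "1 \<in> I h" using I[OF h] by auto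
    hence "h \<in> A" "h + s \<in> A" by (auto simp: I_def)
    from pairs[OF this] h show False by (auto simp: s_def)
  qed
  define f where "f = (\<lambda>r\<in>{1..h}. int (k r) - (if r = h then 0 else int (k (s - r))))"
  have f: "f \<in> PiE {1..h} (charge_range h M)"
  proof (rule PiE_I)
    fix r assume "r \<in> {1..h}"
    thus "f r \<in> charge_range h M r"
      using middle k_le[of r] k_le[of "s - r"] by (auto simp: f_def charge_range_def)
  qed (auto simp: f_def)
  have "x \<in> charges_to_set h f \<longleftrightarrow> x \<in> A" for x
  proof -
    define c where "c = x mod s"
    have c: "c < s" using h by (simp add: c_def s_def)
    have "(if c \<le> h then int i < f c else int i < - f (s - c)) \<longleftrightarrow> i < k c" if "0 < c" for i
    proof -
      consider "c < h" | "c = h" | "h < c" by linarith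
      thus ?thesis
      proof cases
        case 1
        hence "f c = int (k c) - int (k (s - c))" using that by (simp add: f_def)
        thus ?thesis using 1 opposite[OF that 1] by auto
      next
        case 2
        thus ?thesis using h by (simp add: f_def)
      next
        case 3
        hence r: "0 < s - c" "s - c < h" "s - (s - c) = c" using c by (auto simp: s_def)
        hence "f (s - c) = int (k (s - c)) - int (k c)" using r by (simp add: f_def Suc_le_eq)
        thus ?thesis using 3 opposite[OF r(1,2)] r(3) by auto
      qed
    qed
    thus ?thesis
      unfolding mem mem_charges_to_set[OF h f] Let_def s_def[symmetric] c_def[symmetric] by blast
  qed
  thus ?thesis using f by blast
qed

lemma sum_charges_to_set:
  assumes h: "0 < h" and f: "f \<in> PiE {1..h} (charge_range h M)"
  shows "\<Sum>(charges_to_set h f) = (\<Sum>r\<in>{1..h}. \<Sum>(runner (2 * h) r (f r)))"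
  unfolding charges_to_set_def
proof (rule sum.UNION_disjoint)
  show "\<forall>r\<in>{1..h}. \<forall>r'\<in>{1..h}. r \<noteq> r' \<longrightarrow> runner (2 * h) r (f r) \<inter> runner (2 * h) r' (f r') = {}"
    by (auto simp: runner_def)
qed (auto intro: finite_runner)

section \<open>The generating function\<close>

lemma fps_X_power_sum_runner:
  assumes "0 < r" "r < s"
  shows "fps_X ^ \<Sum>(runner s r m) = theta_term (fps_X ^ r) (fps_X ^ (s - r)) m"
  unfolding sum_runner[OF assms] theta_term_def by (simp add: power_add power_mult)

lemma card_charges_eq_cs:
  assumes h: "0 < h" and n: "n \<le> M"
  shows "card {f \<in> PiE {1..h} (charge_range h M). \<Sum>(charges_to_set h f) = n} = cs (2 * h) n"
proof -
  have "bij_betw (charges_to_set h) {f \<in> PiE {1..h} (charge_range h M). \<Sum>(charges_to_set h f) = n}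
          {A. csyd_set (2 * h) A \<and> \<Sum>A = n}"
  proof (rule bij_betw_imageI)
    show "inj_on (charges_to_set h) {f \<in> PiE {1..h} (charge_range h M). \<Sum>(charges_to_set h f) = n}"
      by (rule inj_on_subset[OF inj_on_charges_to_set[OF h]]) auto
    show "charges_to_set h ` {f \<in> PiE {1..h} (charge_range h M). \<Sum>(charges_to_set h f) = n}
            = {A. csyd_set (2 * h) A \<and> \<Sum>A = n}"
    proof (intro equalityI subsetI)
      fix A assume "A \<in> {A. csyd_set (2 * h) A \<and> \<Sum>A = n}"
      hence A: "csyd_set (2 * h) A" "\<Sum>A = n" by auto
      then obtain f where "f \<in> PiE {1..h} (charge_range h M)" "charges_to_set h f = A"
        using csyd_set_eq_charges_to_set[OF h A(1), of M] n by auto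
      thus "A \<in> charges_to_set h ` {f \<in> PiE {1..h} (charge_range h M). \<Sum>(charges_to_set h f) = n}"
        using A by auto
    qed (use csyd_set_charges_to_set[OF h] in auto)
  qed
  thus ?thesis using cs_eq_card_csyd_sets[of "2 * h" n] h by (simp add: bij_betw_same_card)
qed

text \<open>
  The charges are chosen independently, so expanding the product over \<open>r\<close> yields one monomial
  per choice, with the size of the partition as its exponent. The coefficient of \<open>X\<^sup>n\<close> is exact as
  soon as \<open>M \<ge> n\<close>.
\<close>

lemma cs_generating_function_LIMSEQ:
  assumes h: "0 < h"
  shows "(\<lambda>M. \<Prod>r\<in>{1..h}. \<Sum>m\<in>charge_range h M r. theta_term (fps_X ^ r) (fps_X ^ (2 * h - r)) m)
           \<longlonglongrightarrow> Abs_fps (\<lambda>n. of_nat (cs (2 * h) n) :: 'a::comm_ring_1)"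
proof (rule tendsto_fpsI)
  fix n
  have "fps_nth (\<Prod>r\<in>{1..h}. \<Sum>m\<in>charge_range h M r. theta_term (fps_X ^ r) (fps_X ^ (2 * h - r)) m) n
          = (of_nat (cs (2 * h) n) :: 'a)" if n: "n \<le> M" for M
  proof -
    let ?F = "PiE {1..h} (charge_range h M)"
    have fin: "finite ?F" by (intro finite_PiE) (auto simp: charge_range_def)
    have "(\<Prod>r\<in>{1..h}. \<Sum>m\<in>charge_range h M r. theta_term (fps_X ^ r) (fps_X ^ (2 * h - r)) m)
        = (\<Sum>f\<in>?F. \<Prod>r\<in>{1..h}. theta_term (fps_X ^ r) (fps_X ^ (2 * h - r)) (f r) :: 'a fps)"
      by (rule prod_sum_PiE) (auto simp: charge_range_def)
    also have "\<dots> = (\<Sum>f\<in>?F. fps_X ^ \<Sum>(charges_to_set h f))"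
    proof (rule sum.cong[OF refl])
      fix f assume f: "f \<in> ?F"
      have "(\<Prod>r\<in>{1..h}. theta_term (fps_X ^ r) (fps_X ^ (2 * h - r)) (f r) :: 'a fps)
          = (\<Prod>r\<in>{1..h}. fps_X ^ \<Sum>(runner (2 * h) r (f r)))"
        by (intro prod.cong refl fps_X_power_sum_runner[symmetric]) auto
      thus "(\<Prod>r\<in>{1..h}. theta_term (fps_X ^ r) (fps_X ^ (2 * h - r)) (f r) :: 'a fps)
          = fps_X ^ \<Sum>(charges_to_set h f)"
        by (simp add: sum_charges_to_set[OF h f] power_sum)
    qed
    finally have "fps_nth (\<Prod>r\<in>{1..h}. \<Sum>m\<in>charge_range h M r. theta_term (fps_X ^ r) (fps_X ^ (2 * h - r)) m) n
        = (\<Sum>f\<in>?F. if \<Sum>(charges_to_set h f) = n then 1 else 0 :: 'a)"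
      by (simp only: fps_sum_nth fps_X_power_nth eq_commute[of n])
    also have "\<dots> = of_nat (card {f \<in> ?F. \<Sum>(charges_to_set h f) = n})"
      using fin by (simp add: sum.If_cases Int_def)
    finally show ?thesis by (simp only: card_charges_eq_cs[OF h n])
  qed
  thus "eventually (\<lambda>M. fps_nth (\<Prod>r\<in>{1..h}. \<Sum>m\<in>charge_range h M r.
            theta_term (fps_X ^ r) (fps_X ^ (2 * h - r)) m) n
          = fps_nth (Abs_fps (\<lambda>n. of_nat (cs (2 * h) n) :: 'a)) n) sequentially"
    unfolding fps_nth_Abs_fps eventually_sequentially by blast
qed

lemma cs_generating_function_residues:
  assumes h: "0 < h"
  shows "Abs_fps (\<lambda>n. of_nat (cs (2 * h) n) :: 'a::field)
    = (1 + fps_X ^ h) * (\<Prod>r\<in>{1..<h}. qpoch_inf (- (fps_X ^ r)) (fps_X ^ (2 * h))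
        * qpoch_inf (- (fps_X ^ (2 * h - r))) (fps_X ^ (2 * h)) * qpoch_inf (fps_X ^ (2 * h)) (fps_X ^ (2 * h)))"
    (is "?G = (1 + fps_X ^ h) * (\<Prod>r\<in>{1..<h}. ?J r)")
proof -
  let ?t = "\<lambda>r. theta_term (fps_X ^ r) (fps_X ^ (2 * h - r)) :: int \<Rightarrow> 'a fps"
  have finite: "(\<Prod>r\<in>{1..h}. \<Sum>m\<in>charge_range h M r. ?t r m)
      = (1 + fps_X ^ h) * (\<Prod>r\<in>{1..<h}. \<Sum>m\<in>{- int M..int M}. ?t r m)" for M
  proof -
    have "{1..h} = insert h {1..<h}" using h by auto
    moreover have "(\<Sum>m\<in>charge_range h M h. ?t h m) = 1 + fps_X ^ h"
      by (simp add: charge_range_def theta_term_def)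
    moreover have "(\<Prod>r\<in>{1..<h}. \<Sum>m\<in>charge_range h M r. ?t r m)
        = (\<Prod>r\<in>{1..<h}. \<Sum>m\<in>{- int M..int M}. ?t r m)"
      by (intro prod.cong) (auto simp: charge_range_def)
    ultimately show ?thesis by simp
  qed
  have "(\<lambda>M. (1 + fps_X ^ h) * (\<Prod>r\<in>{1..<h}. \<Sum>m\<in>{- int M..int M}. ?t r m)) \<longlonglongrightarrow> ?G"
    using cs_generating_function_LIMSEQ[OF h, where 'a = 'a] by (simp only: finite)
  moreover have "(\<lambda>M. (1 + fps_X ^ h) * (\<Prod>r\<in>{1..<h}. \<Sum>m\<in>{- int M..int M}. ?t r m))
      \<longlonglongrightarrow> (1 + fps_X ^ h) * (\<Prod>r\<in>{1..<h}. ?J r)"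
  proof (intro tendsto_mult tendsto_const tendsto_prod')
    fix r assume "r \<in> {1..<h}"
    hence r: "0 < r" "r < h" by auto
    have q: "(fps_X ^ r * fps_X ^ (2 * h - r) :: 'a fps) = fps_X ^ (2 * h)"
      using r by (simp flip: power_add)
    have "fps_nth (fps_X ^ r :: 'a fps) 0 = 0" "fps_nth (fps_X ^ (2 * h - r) :: 'a fps) 0 = 0"
      using r by simp_all
    from jacobi_triple_product_fps[OF this]
    show "(\<lambda>M. \<Sum>m\<in>{- int M..int M}. ?t r m) \<longlonglongrightarrow> ?J r" unfolding q .
  qed
  ultimately show ?thesis by (rule LIMSEQ_unique)
qed

text \<open>
  It remains to regroup the infinite products. Write \<open>Q j\<close> for the product of \<open>1 + X\<^bsup>j + si\<^esup>\<close>
  over \<open>i \<ge> 0\<close>. The product of \<open>Q 1, ..., Q s\<close> is \<open>(-X; X)\<close>, in which the triple products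
  account for all factors but \<open>Q h\<close> and \<open>Q s\<close>; and \<open>Q h Q s = (-X\<^sup>h; X\<^sup>h)\<close> is the denominator
  times the factor \<open>1 + X\<^sup>h\<close> contributed by the part \<open>h\<close>.
\<close>

theorem proposition2p9:
  fixes s :: nat
  assumes "even s" and "0 < s"
  shows "Abs_fps (\<lambda>n. of_nat (cs s n)) =
           qpoch_inf (- fps_X) fps_X * qpoch_inf (fps_X ^ s) (fps_X ^ s) ^ ((s - 2) div 2)
             / (qpoch_inf (- (fps_X ^ s)) (fps_X ^ (s div 2)) :: rat fps)"
proof -
  define h where "h = s div 2"
  have s: "s = 2 * h" and h: "0 < h" using assms by (auto simp: h_def)
  let ?X = "fps_X :: rat fps"
  define Q where "Q j = qpoch_inf (- (?X ^ j)) (?X ^ s)" for j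
  define E where "E = qpoch_inf (?X ^ s) (?X ^ s)"
  define D where "D = qpoch_inf (- (?X ^ s)) (?X ^ h)"
  have "Q h * Q s = (\<Prod>r<2. qpoch_inf (- (?X ^ h) * (?X ^ h) ^ r) ((?X ^ h) ^ 2))"
    by (simp add: Q_def s numeral_2_eq_2 mult_2 power_add)
  also have "\<dots> = qpoch_inf (- (?X ^ h)) (?X ^ h)"
    by (rule qpoch_inf_split_residues[symmetric]) (use h in auto)
  also have "\<dots> = (1 + ?X ^ h) * D"
    using qpoch_inf_shift[of "- (?X ^ h)" "?X ^ h"] h by (simp add: D_def s mult_2 power_add)
  finally have QD: "(1 + ?X ^ h) * D = Q h * Q s" ..
  have "qpoch_inf (- ?X) ?X = (\<Prod>r<s. qpoch_inf (- ?X * ?X ^ r) (?X ^ s))"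
    by (rule qpoch_inf_split_residues) (use assms in auto)
  also have "\<dots> = (\<Prod>j\<in>{1..s}. Q j)"
    by (rule prod.reindex_bij_witness[of _ "\<lambda>j. j - 1" Suc]) (auto simp: Q_def)
  also have "{1..s} = {1..<h} \<union> {h + 1..<s} \<union> {h, s}" using s h by auto
  also have "(\<Prod>j\<in>\<dots>. Q j) = (\<Prod>j\<in>{1..<h}. Q j) * (\<Prod>j\<in>{h + 1..<s}. Q j) * (Q h * Q s)"
  proof -
    have "prod Q ({1..<h} \<union> {h + 1..<s} \<union> {h, s}) = prod Q ({1..<h} \<union> {h + 1..<s}) * prod Q {h, s}"
      by (rule prod.union_disjoint) (use s in auto)
    also have "prod Q ({1..<h} \<union> {h + 1..<s}) = prod Q {1..<h} * prod Q {h + 1..<s}"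
      by (rule prod.union_disjoint) auto
    also have "prod Q {h, s} = Q h * Q s" using s h by simp
    finally show ?thesis .
  qed
  also have "(\<Prod>j\<in>{h + 1..<s}. Q j) = (\<Prod>r\<in>{1..<h}. Q (s - r))"
    by (rule prod.reindex_bij_witness[of _ "\<lambda>r. s - r" "\<lambda>r. s - r"]) (auto simp: s)
  finally have all: "qpoch_inf (- ?X) ?X
      = (\<Prod>r\<in>{1..<h}. Q r) * (\<Prod>r\<in>{1..<h}. Q (s - r)) * (Q h * Q s)" .
  have "Abs_fps (\<lambda>n. of_nat (cs s n)) = (1 + ?X ^ h) * (\<Prod>r\<in>{1..<h}. Q r * Q (s - r) * E)"
    using cs_generating_function_residues[OF h, where 'a = rat] by (simp add: s Q_def E_def)
  also have "(\<Prod>r\<in>{1..<h}. Q r * Q (s - r) * E)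
      = (\<Prod>r\<in>{1..<h}. Q r) * (\<Prod>r\<in>{1..<h}. Q (s - r)) * E ^ (h - 1)"
    by (simp add: prod.distrib)
  finally have "Abs_fps (\<lambda>n. of_nat (cs s n)) * D
      = (\<Prod>r\<in>{1..<h}. Q r) * (\<Prod>r\<in>{1..<h}. Q (s - r)) * ((1 + ?X ^ h) * D) * E ^ (h - 1)"
    by (simp only: mult_ac)
  also have "\<dots> = qpoch_inf (- ?X) ?X * E ^ (h - 1)"
    unfolding all QD by (simp only: mult_ac)
  finally have "Abs_fps (\<lambda>n. of_nat (cs s n)) * D = qpoch_inf (- ?X) ?X * E ^ (h - 1)" .
  moreover have "D \<noteq> 0"
    using qpoch_inf_nth_0[of "- (?X ^ s)" "?X ^ h"] assms h by (auto simp: D_def)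
  ultimately have "Abs_fps (\<lambda>n. of_nat (cs s n)) = qpoch_inf (- ?X) ?X * E ^ (h - 1) / D"
    by (metis nonzero_mult_div_cancel_right)
  moreover have "(s - 2) div 2 = h - 1" by (simp add: s)
  ultimately show ?thesis by (simp add: E_def D_def h_def)
qed

end
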